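(* Let $\mathrm{mCoarse}$ be the category whose objects are metric spaces and whose morphisms are coarse maps modulo closeness, and let $\mathrm{Top}$ be the category of topological spaces and continuous maps. Then the corona construction $$\nu':\mathrm{mCoarse}\to \mathrm{Top},\qquad X\mapsto \nu' X,\quad f\mapsto \nu' f,$$ is a functor. Moreover, if $X$ is a metric space then $\nu' X$ is compact.
   Context: All metrics take finite values. For a metric space $X$, an entourage is a set $E\subseteq X^2$ with $\sup_{(x,y)\in E}d(x,y)<\infty$; a subset $B\subseteq X$ is bounded if $B^2$ is an entourage; $E[A]$ denotes the set of points of $X$ that are $E$-related to some point of $A$. A map $f:X\to Y$ of metric spaces is coarse if $(f\times f)(E)$ is an entourage for every entourage $E\subseteq X^2$ and $f^{-1}(B)$ is bounded for every bounded $B\subseteq Y$. Two maps $f,g:X\to Y$ are close if $\{(f(x),g(x)):x\in X\}$ is an entourage in $Y$. Close subsets: $A,B\subseteq X$ are coarsely disjoint if $E[A]\cap E[B]$ is bounded for every entourage $E$; otherwise they are called close, written $A\curlywedge B$. Write $A\not\curlywedge B$ for coarsely disjoint. A coarse ultrafilter on $X$ is a system $\mathcal F$ of subsets of $X$ such that (1) $A,B\in\mathcal F$ implies $A\curlywedge B$; (2) if $A,B\subseteq X$ and $A\cup B\in\mathcal F$ then $A\in\mathcal F$ or $B\in\mathcal F$; (3) $X\in\mathcal F$. Two coarse ultrafilters $\mathcal F,\mathcal G$ on $X$ are asymptotically alike, $\mathcal F\lambda\mathcal G$, if $A\curlywedge B$ for all $A\in\mathcal F$, $B\in\mathcal G$;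 this is an equivalence relation. The corona: $\hat\nu(X)$ is the set of coarse ultrafilters on $X$ and $\nu' X=\hat\nu(X)/\lambda$. For $A\subseteq X$ let $\mathrm{cl}(A)\subseteq\nu' X$ be the set of classes having a representative $\mathcal F$ with $A\in\mathcal F$. For $\pi_1,\pi_2\subseteq\nu' X$ put $\pi_1\not\curlywedge\pi_2$ if there are $A,B\subseteq X$ with $A\not\curlywedge B$, $\pi_1\subseteq\mathrm{cl}(A)$, $\pi_2\subseteq\mathrm{cl}(B)$, and $\pi_1\curlywedge\pi_2$ otherwise. This is a separated proximity relation and $\nu' X$ carries the induced topology, in which the closure of $\pi$ is $\{x:\{x\}\curlywedge\pi\}$. For a coarse map $f:X\to Y$ and a coarse ultrafilter $\mathcal F$ on $X$, $f_*\mathcal F=\{A\subseteq Y: f^{-1}(A)\in\mathcal F\}$, and $\nu' f:\nu' X\to\nu' Y$ is $[\mathcal F]\mapsto[f_*\mathcal F]$. *)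

theory Defs
  imports "HOL-Analysis.Analysis"
begin

section \<open>Categories and functors\<close>

text \<open>Hom-sets are indexed by objects and need not be disjoint, so composition takes the three
  objects as arguments: \<open>cmp C X Y Z g f\<close> is \<open>g\<close> after \<open>f\<close> for \<open>f\<close> from \<open>X\<close> to \<open>Y\<close> and \<open>g\<close> from
  \<open>Y\<close> to \<open>Z\<close>.\<close>

record ('o, 'm) precategory =
  Obj :: "'o set"
  Hom :: "'o \<Rightarrow> 'o \<Rightarrow> 'm set"
  ident :: "'o \<Rightarrow> 'm"
  cmp :: "'o \<Rightarrow> 'o \<Rightarrow> 'o \<Rightarrow> 'm \<Rightarrow> 'm \<Rightarrow> 'm"

locale category =
  fixes C :: "('o, 'm) precategory"
  assumes ident_in_Hom: "X \<in> Obj C \<Longrightarrow> ident C X \<in> Hom C X X"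
    and cmp_in_Hom: "\<lbrakk>X \<in> Obj C; Y \<in> Obj C; Z \<in> Obj C; f \<in> Hom C X Y; g \<in> Hom C Y Z\<rbrakk>
      \<Longrightarrow> cmp C X Y Z g f \<in> Hom C X Z"
    and cmp_ident_left: "\<lbrakk>X \<in> Obj C; Y \<in> Obj C; f \<in> Hom C X Y\<rbrakk>
      \<Longrightarrow> cmp C X Y Y (ident C Y) f = f"
    and cmp_ident_right: "\<lbrakk>X \<in> Obj C; Y \<in> Obj C; f \<in> Hom C X Y\<rbrakk>
      \<Longrightarrow> cmp C X X Y f (ident C X) = f"
    and cmp_assoc: "\<lbrakk>W \<in> Obj C; X \<in> Obj C; Y \<in> Obj C; Z \<in> Obj C;
        f \<in> Hom C W X; g \<in> Hom C X Y; h \<in> Hom C Y Z\<rbrakk>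
      \<Longrightarrow> cmp C W X Z (cmp C X Y Z h g) f = cmp C W Y Z h (cmp C W X Y g f)"

locale cat_functor = C: category C + D: category D
  for C :: "('o1, 'm1) precategory" and D :: "('o2, 'm2) precategory" +
  fixes on_obj :: "'o1 \<Rightarrow> 'o2" and on_hom :: "'o1 \<Rightarrow> 'o1 \<Rightarrow> 'm1 \<Rightarrow> 'm2"
  assumes on_obj: "X \<in> Obj C \<Longrightarrow> on_obj X \<in> Obj D"
    and on_hom: "\<lbrakk>X \<in> Obj C; Y \<in> Obj C; f \<in> Hom C X Y\<rbrakk>
      \<Longrightarrow> on_hom X Y f \<in> Hom D (on_obj X) (on_obj Y)"
    and on_ident: "X \<in> Obj C \<Longrightarrow> on_hom X X (ident C X) = ident D (on_obj X)"
    and on_cmp: "\<lbrakk>X \<in> Obj C; Y \<in> Obj C; Z \<in> Obj C; f \<in> Hom C X Y; g \<in> Hom C Y Z\<rbrakk>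
      \<Longrightarrow> on_hom X Z (cmp C X Y Z g f)
        = cmp D (on_obj X) (on_obj Y) (on_obj Z) (on_hom Y Z g) (on_hom X Y f)"

text \<open>Functions out of a topological space are made unique by extensionality outside its carrier.\<close>

definition Top :: "('a topology, 'a \<Rightarrow> 'a) precategory" where
  "Top = \<lparr>Obj = UNIV,
    Hom = (\<lambda>S T. {f \<in> extensional (topspace S). continuous_map S T f}),
    ident = (\<lambda>S. restrict id (topspace S)),
    cmp = (\<lambda>S T U g f. compose (topspace S) g f)\<rparr>"


section \<open>The category of metric spaces and coarse maps modulo closeness\<close>

definition entourage :: "'a metric \<Rightarrow> ('a \<times> 'a) set \<Rightarrow> bool" where
  "entourage X E \<longleftrightarrow>
    E \<subseteq> mspace X \<times> mspace X \<and> bdd_above ((\<lambda>(x, y). mdist X x y) ` E)"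

definition bounded_in :: "'a metric \<Rightarrow> 'a set \<Rightarrow> bool" where
  "bounded_in X B \<longleftrightarrow> entourage X (B \<times> B)"

definition coarse_maps :: "'a metric \<Rightarrow> 'b metric \<Rightarrow> ('a \<Rightarrow> 'b) set" where
  "coarse_maps X Y = {f \<in> mspace X \<rightarrow> mspace Y.
    (\<forall>E. entourage X E \<longrightarrow> entourage Y (map_prod f f ` E)) \<and>
    (\<forall>B. bounded_in Y B \<longrightarrow> bounded_in X (f -` B \<inter> mspace X))}"

definition close_maps :: "'a metric \<Rightarrow> 'b metric \<Rightarrow> (('a \<Rightarrow> 'b) \<times> ('a \<Rightarrow> 'b)) set" where
  "close_maps X Y = {(f, g). f \<in> coarse_maps X Y \<and> g \<in> coarse_maps X Y \<and>
    entourage Y ((\<lambda>x. (f x, g x)) ` mspace X)}"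

text \<open>Values of a map outside \<open>mspace X\<close> are irrelevant to closeness, so closeness classes
  are closed under changing maps there, and no extensionality condition is needed.\<close>

definition mCoarse :: "('a metric, ('a \<Rightarrow> 'a) set) precategory" where
  "mCoarse = \<lparr>Obj = UNIV,
    Hom = (\<lambda>X Y. coarse_maps X Y // close_maps X Y),
    ident = (\<lambda>X. close_maps X X `` {id}),
    cmp = (\<lambda>X Y Z G F. \<Union>g\<in>G. \<Union>f\<in>F. close_maps X Z `` {g \<circ> f})\<rparr>"


section \<open>The corona\<close>

text \<open>\<open>E\<inverse> `` A\<close> is the set of points that are \<open>E\<close>-related to some point of \<open>A\<close>.\<close>

definition coarsely_disjoint :: "'a metric \<Rightarrow> 'a set \<Rightarrow> 'a set \<Rightarrow> bool" where
  "coarsely_disjoint X A B \<longleftrightarrow>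
    (\<forall>E. entourage X E \<longrightarrow> bounded_in X (E\<inverse> `` A \<inter> E\<inverse> `` B))"

abbreviation close_sets :: "'a metric \<Rightarrow> 'a set \<Rightarrow> 'a set \<Rightarrow> bool" where
  "close_sets X A B \<equiv> \<not> coarsely_disjoint X A B"

definition coarse_ultrafilters :: "'a metric \<Rightarrow> 'a set set set" where
  "coarse_ultrafilters X = {F. F \<subseteq> Pow (mspace X) \<and>
    (\<forall>A\<in>F. \<forall>B\<in>F. close_sets X A B) \<and>
    (\<forall>A B. A \<subseteq> mspace X \<longrightarrow> B \<subseteq> mspace X \<longrightarrow> A \<union> B \<in> F \<longrightarrow> A \<in> F \<or> B \<in> F) \<and>
    mspace X \<in> F}"

definition alike :: "'a metric \<Rightarrow> ('a set set \<times> 'a set set) set" where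
  "alike X = {(F, G). F \<in> coarse_ultrafilters X \<and> G \<in> coarse_ultrafilters X \<and>
    (\<forall>A\<in>F. \<forall>B\<in>G. close_sets X A B)}"

definition corona_points :: "'a metric \<Rightarrow> 'a set set set set" where
  "corona_points X = coarse_ultrafilters X // alike X"

definition corona_cl :: "'a metric \<Rightarrow> 'a set \<Rightarrow> 'a set set set set" where
  "corona_cl X A = {p \<in> corona_points X. \<exists>F\<in>p. A \<in> F}"

definition corona_far ::
  "'a metric \<Rightarrow> 'a set set set set \<Rightarrow> 'a set set set set \<Rightarrow> bool" where
  "corona_far X P Q \<longleftrightarrow> (\<exists>A B. A \<subseteq> mspace X \<and> B \<subseteq> mspace X \<and>
    coarsely_disjoint X A B \<and> P \<subseteq> corona_cl X A \<and> Q \<subseteq> corona_cl X B)"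

abbreviation corona_close ::
  "'a metric \<Rightarrow> 'a set set set set \<Rightarrow> 'a set set set set \<Rightarrow> bool" where
  "corona_close X P Q \<equiv> \<not> corona_far X P Q"

text \<open>A set is open iff its complement contains every point that is close to the complement;
  \<open>istopology_corona\<close> and \<open>closure_of_corona\<close> below show that this is a topology with the
  closure operator induced by the proximity.\<close>

definition corona :: "'a metric \<Rightarrow> 'a set set set topology" where
  "corona X = topology (\<lambda>U. U \<subseteq> corona_points X \<and>
    (\<forall>p\<in>corona_points X. corona_close X {p} (corona_points X - U) \<longrightarrow> p \<notin> U))"

definition pushforward ::
  "'a metric \<Rightarrow> 'b metric \<Rightarrow> ('a \<Rightarrow> 'b) \<Rightarrow> 'a set set \<Rightarrow> 'b set set" where
  "pushforward X Y f F = {A. A \<subseteq> mspace Y \<and> f -` A \<inter> mspace X \<in> F}"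

text \<open>The class of the pushforward of any representative; as for other operations on quotients,
  independence of the representative means that the union is over equal classes.\<close>

definition corona_map ::
  "'a metric \<Rightarrow> 'b metric \<Rightarrow> ('a \<Rightarrow> 'b) \<Rightarrow> 'a set set set \<Rightarrow> 'b set set set" where
  "corona_map X Y f = (\<lambda>p\<in>corona_points X. \<Union>F\<in>p. alike Y `` {pushforward X Y f F})"

definition corona_hom ::
  "'a metric \<Rightarrow> 'b metric \<Rightarrow> ('a \<Rightarrow> 'b) set \<Rightarrow> 'a set set set \<Rightarrow> 'b set set set" where
  "corona_hom X Y \<Phi> = (\<lambda>p\<in>corona_points X. \<Union>f\<in>\<Phi>. corona_map X Y f p)"


section \<open>The corona topology is well defined\<close>

lemma bounded_in_iff:
  "bounded_in X B \<longleftrightarrow> B \<subseteq> mspace X \<and> (\<exists>C. \<forall>x\<in>B. \<forall>y\<in>B. mdist X x y \<le> C)"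
  unfolding bounded_in_def entourage_def bdd_above_def by auto

lemma bounded_in_subset: "bounded_in X B \<Longrightarrow> A \<subseteq> B \<Longrightarrow> bounded_in X A"
  unfolding bounded_in_iff by (meson subset_iff)

lemma bounded_in_thicken:
  assumes B: "bounded_in X B" and S: "S \<subseteq> mspace X"
    and near: "\<And>x. x \<in> S \<Longrightarrow> \<exists>y\<in>B. mdist X x y \<le> r"
  shows "bounded_in X S"
proof -
  obtain C where C: "\<And>x y. x \<in> B \<Longrightarrow> y \<in> B \<Longrightarrow> mdist X x y \<le> C" and BX: "B \<subseteq> mspace X"
    using B unfolding bounded_in_iff by blast
  have "mdist X x y \<le> r + C + r" if "x \<in> S" "y \<in> S" for x y
  proof -
    obtain x' y' where xy: "x' \<in> B" "mdist X x x' \<le> r" "y' \<in> B" "mdist X y y' \<le> r"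
      using near \<open>x \<in> S\<close> \<open>y \<in> S\<close> by meson
    have X: "x \<in> mspace X" "y \<in> mspace X" "x' \<in> mspace X" "y' \<in> mspace X"
      using that xy S BX by auto
    have "mdist X x y \<le> mdist X x x' + mdist X x' y"
      "mdist X x' y \<le> mdist X x' y' + mdist X y' y" "mdist X y' y = mdist X y y'"
      using X by (auto intro: mdist_triangle mdist_commute)
    with C[OF xy(1,3)] xy show ?thesis by linarith
  qed
  with S show ?thesis unfolding bounded_in_iff by blast
qed

lemma bounded_in_Un:
  assumes "bounded_in X A" "bounded_in X B"
  shows "bounded_in X (A \<union> B)"
proof (cases "A = {} \<or> B = {}")
  case True
  then show ?thesis using assms by auto
next
  case False
  then obtain a b where ab: "a \<in> A" "b \<in> B" by blast
  obtain C where C: "\<And>x y. x \<in> A \<Longrightarrow> y \<in> A \<Longrightarrow> mdist X x y \<le> C" and AX: "A \<subseteq> mspace X"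
    using assms unfolding bounded_in_iff by blast
  obtain D where D: "\<And>x y. x \<in> B \<Longrightarrow> y \<in> B \<Longrightarrow> mdist X x y \<le> D" and BX: "B \<subseteq> mspace X"
    using assms unfolding bounded_in_iff by blast
  show ?thesis
  proof (rule bounded_in_thicken)
    show "bounded_in X {a, b}"
      unfolding bounded_in_iff using ab AX BX
      by (auto intro!: exI[of _ "Max {mdist X a a, mdist X a b, mdist X b a, mdist X b b}"])
    show "\<exists>y\<in>{a, b}. mdist X x y \<le> max C D" if "x \<in> A \<union> B" for x
      using that C[of x a] D[of x b] ab by (auto simp: le_max_iff_disj)
  qed (use AX BX in auto)
qed

definition both_near :: "'a metric \<Rightarrow> real \<Rightarrow> 'a set \<Rightarrow> 'a set \<Rightarrow> 'a set" where
  "both_near X r A B = {z \<in> mspace X.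
    (\<exists>a\<in>A \<inter> mspace X. mdist X z a \<le> r) \<and> (\<exists>b\<in>B \<inter> mspace X. mdist X z b \<le> r)}"

lemma coarsely_disjoint_iff:
  "coarsely_disjoint X A B \<longleftrightarrow> (\<forall>r. bounded_in X (both_near X r A B))"
proof
  assume dis: "coarsely_disjoint X A B"
  show "\<forall>r. bounded_in X (both_near X r A B)"
  proof
    fix r
    let ?E = "{(x, y). x \<in> mspace X \<and> y \<in> mspace X \<and> mdist X x y \<le> r}"
    have "entourage X ?E" unfolding entourage_def bdd_above_def by auto
    then have "bounded_in X (?E\<inverse> `` A \<inter> ?E\<inverse> `` B)"
      using dis unfolding coarsely_disjoint_def by blast
    moreover have "both_near X r A B \<subseteq> ?E\<inverse> `` A \<inter> ?E\<inverse> `` B" unfolding both_near_def by auto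
    ultimately show "bounded_in X (both_near X r A B)" by (rule bounded_in_subset)
  qed
next
  assume near: "\<forall>r. bounded_in X (both_near X r A B)"
  show "coarsely_disjoint X A B"
    unfolding coarsely_disjoint_def
  proof (intro allI impI)
    fix E assume E: "entourage X E"
    then obtain r where "\<forall>p\<in>E. (case p of (x, y) \<Rightarrow> mdist X x y) \<le> r"
      unfolding entourage_def bdd_above_def by auto
    then have "\<And>x y. (x, y) \<in> E \<Longrightarrow> mdist X x y \<le> r" by fast
    with E have "E\<inverse> `` A \<inter> E\<inverse> `` B \<subseteq> both_near X r A B"
      unfolding both_near_def entourage_def by fastforce
    with near show "bounded_in X (E\<inverse> `` A \<inter> E\<inverse> `` B)"
      using bounded_in_subset by blast
  qed
qed

lemma coarsely_disjoint_sym: "coarsely_disjoint X A B \<Longrightarrow> coarsely_disjoint X B A"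
  unfolding coarsely_disjoint_def by (simp add: Int_commute)

lemma coarsely_disjoint_mono:
  assumes "coarsely_disjoint X A B" "A' \<subseteq> A" "B' \<subseteq> B"
  shows "coarsely_disjoint X A' B'"
proof -
  have "both_near X r A' B' \<subseteq> both_near X r A B" for r
    using assms(2,3) unfolding both_near_def by blast
  with assms(1) show ?thesis unfolding coarsely_disjoint_iff using bounded_in_subset by blast
qed

lemma coarsely_disjoint_Un:
  assumes "coarsely_disjoint X A B" "coarsely_disjoint X A C"
  shows "coarsely_disjoint X A (B \<union> C)"
proof -
  have "both_near X r A (B \<union> C) = both_near X r A B \<union> both_near X r A C" for r
    unfolding both_near_def by blast
  with assms show ?thesis unfolding coarsely_disjoint_iff using bounded_in_Un by metis
qed

lemma coarsely_disjoint_separation: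
  assumes AB: "coarsely_disjoint X A B"
  obtains C D where "C \<union> D = mspace X" "coarsely_disjoint X A C" "coarsely_disjoint X B D"
proof -
  define N where "N = (\<lambda>r A. {z \<in> mspace X. \<exists>a\<in>A \<inter> mspace X. mdist X z a \<le> r})"
  define D where "D = {z \<in> mspace X. \<forall>r. z \<in> N r B \<longrightarrow> z \<in> N (r + 1) A}"
  define C where "C = mspace X - D"
  have key: "bounded_in X (both_near X r P Q)"
    if Q: "\<And>z s. z \<in> Q \<Longrightarrow> z \<in> N s P \<Longrightarrow> z \<in> both_near X (s + 1) A B" for r P Q
  proof (rule bounded_in_thicken[where B = "both_near X (2 * r + 1) A B" and r = r])
    show "bounded_in X (both_near X (2 * r + 1) A B)"
      using AB unfolding coarsely_disjoint_iff by blast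
    show "both_near X r P Q \<subseteq> mspace X" unfolding both_near_def by blast
    fix z assume "z \<in> both_near X r P Q"
    then obtain p q where pq: "z \<in> mspace X" "p \<in> P" "p \<in> mspace X" "mdist X z p \<le> r"
      "q \<in> Q" "q \<in> mspace X" "mdist X z q \<le> r" unfolding both_near_def by auto
    have "mdist X q p \<le> mdist X q z + mdist X z p" "mdist X q z = mdist X z q"
      using pq by (auto intro: mdist_triangle mdist_commute)
    with pq have "mdist X q p \<le> 2 * r" by linarith
    with pq have "q \<in> N (2 * r) P" unfolding N_def by blast
    then show "\<exists>y\<in>both_near X (2 * r + 1) A B. mdist X z y \<le> r" using Q pq by blast
  qed
  have widen: "z \<in> N s P \<Longrightarrow> s \<le> t \<Longrightarrow> z \<in> N t P" for z s t P
    unfolding N_def by (auto intro: order_trans)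
  have both: "z \<in> both_near X r A B \<longleftrightarrow> z \<in> N r A \<and> z \<in> N r B" for z r
    unfolding both_near_def N_def by blast
  have "z \<in> both_near X (s + 1) A B" if C: "z \<in> C" and sA: "z \<in> N s A" for z s
  proof -
    obtain r where r: "z \<in> N r B" "z \<notin> N (r + 1) A" using C unfolding C_def D_def by blast
    with sA have "r \<le> s + 1" using widen[of z s A "r + 1"] by linarith
    with r sA show ?thesis unfolding both by (auto intro: widen)
  qed
  then have "coarsely_disjoint X A C" unfolding coarsely_disjoint_iff using key by blast
  moreover have "z \<in> both_near X (s + 1) A B" if D: "z \<in> D" and sB: "z \<in> N s B" for z s
    using D sB unfolding both D_def by (auto intro: widen)
  then have "coarsely_disjoint X B D" unfolding coarsely_disjoint_iff using key by blast
  moreover have "C \<union> D = mspace X" unfolding C_def D_def by blast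
  ultimately show thesis using that by blast
qed

lemma coarse_ultrafilterD:
  assumes "F \<in> coarse_ultrafilters X"
  shows "A \<in> F \<Longrightarrow> A \<subseteq> mspace X"
    and "A \<in> F \<Longrightarrow> B \<in> F \<Longrightarrow> close_sets X A B"
    and "A \<union> B \<in> F \<Longrightarrow> A \<in> F \<or> B \<in> F"
    and "mspace X \<in> F"
proof -
  show subset: "A \<subseteq> mspace X" if "A \<in> F" for A
    using assms that unfolding coarse_ultrafilters_def by blast
  show "A \<in> F \<Longrightarrow> B \<in> F \<Longrightarrow> close_sets X A B" and "mspace X \<in> F"
    using assms unfolding coarse_ultrafilters_def by simp_all
  show "A \<in> F \<or> B \<in> F" if "A \<union> B \<in> F"
  proof -
    have "A \<subseteq> mspace X" "B \<subseteq> mspace X" using subset[OF that] by simp_all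
    then show ?thesis using assms that unfolding coarse_ultrafilters_def by simp
  qed
qed

lemma equiv_alike: "equiv (coarse_ultrafilters X) (alike X)"
proof (rule equivI)
  show "alike X \<subseteq> coarse_ultrafilters X \<times> coarse_ultrafilters X"
    unfolding alike_def by auto
  show "refl_on (coarse_ultrafilters X) (alike X)"
    unfolding refl_on_def alike_def coarse_ultrafilters_def by auto
  show "sym (alike X)"
    by (rule symI) (auto simp: alike_def dest: coarsely_disjoint_sym)
  show "trans (alike X)"
  proof (rule transI)
    fix F G H assume FG: "(F, G) \<in> alike X" and GH: "(G, H) \<in> alike X"
    have "close_sets X A B" if A: "A \<in> F" and B: "B \<in> H" for A B
    proof
      assume "coarsely_disjoint X A B"
      then obtain C D where CD: "C \<union> D = mspace X" "coarsely_disjoint X A C"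
        "coarsely_disjoint X B D" by (rule coarsely_disjoint_separation)
      have G: "G \<in> coarse_ultrafilters X" using FG unfolding alike_def by simp
      have "C \<in> G \<or> D \<in> G"
        using coarse_ultrafilterD(3,4)[OF G] CD(1) by metis
      then show False
        using CD(2) coarsely_disjoint_sym[OF CD(3)] FG GH A B unfolding alike_def by auto
    qed
    with FG GH show "(F, H) \<in> alike X" unfolding alike_def by blast
  qed
qed

lemma corona_cl_Un_mspace:
  assumes "p \<in> corona_points X" "C \<union> D = mspace X"
  shows "p \<in> corona_cl X C \<or> p \<in> corona_cl X D"
proof -
  obtain F where F: "F \<in> coarse_ultrafilters X" "p = alike X `` {F}"
    using assms(1) unfolding corona_points_def by (rule quotientE)
  then have "F \<in> p" using equiv_class_self[OF equiv_alike F(1)] by simp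
  moreover have "C \<in> F \<or> D \<in> F"
    using coarse_ultrafilterD(3,4)[OF F(1)] assms(2) by metis
  ultimately show ?thesis unfolding corona_cl_def using assms(1) by auto
qed

lemma corona_cl_disjoint:
  assumes "coarsely_disjoint X A B"
  shows "corona_cl X A \<inter> corona_cl X B = {}"
proof -
  have False if "p \<in> corona_points X" "F \<in> p" "A \<in> F" "G \<in> p" "B \<in> G" for p F G
  proof -
    have "(F, G) \<in> alike X"
      using that quotient_eq_iff[OF equiv_alike] unfolding corona_points_def by blast
    with that assms show False unfolding alike_def by blast
  qed
  then show ?thesis unfolding corona_cl_def by blast
qed

lemma corona_cl_mono:
  assumes "A \<subseteq> B" "B \<subseteq> mspace X"
  shows "corona_cl X A \<subseteq> corona_cl X B"
proof
  fix p assume "p \<in> corona_cl X A"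
  then obtain F where p: "p \<in> corona_points X" "F \<in> p" "A \<in> F" unfolding corona_cl_def by blast
  have F: "F \<in> coarse_ultrafilters X"
    using p in_quotient_imp_subset[OF equiv_alike] unfolding corona_points_def by blast
  define G where "G = {C. C \<subseteq> mspace X \<and> (\<exists>A\<in>F. A \<subseteq> C)}"
  have close: "close_sets X C D" if "C' \<in> F" "C' \<subseteq> C" "D' \<in> F" "D' \<subseteq> D" for C C' D D'
    using that coarse_ultrafilterD(2)[OF F] coarsely_disjoint_mono by metis
  have prime: "C \<in> G \<or> D \<in> G" if CD: "C \<subseteq> mspace X" "D \<subseteq> mspace X" "C \<union> D \<in> G" for C D
  proof -
    obtain A' where A': "A' \<in> F" "A' \<subseteq> C \<union> D" using CD unfolding G_def by blast
    then have "A' = (A' \<inter> C) \<union> (A' \<inter> D)" by blast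
    then have "A' \<inter> C \<in> F \<or> A' \<inter> D \<in> F"
      using coarse_ultrafilterD(3)[OF F] A'(1) by metis
    then show ?thesis using CD unfolding G_def by blast
  qed
  have "mspace X \<in> G" using coarse_ultrafilterD(4)[OF F] unfolding G_def by blast
  moreover have "close_sets X C D" if "C \<in> G" "D \<in> G" for C D
    using that close unfolding G_def by blast
  moreover have "G \<subseteq> Pow (mspace X)" unfolding G_def by blast
  ultimately have G: "G \<in> coarse_ultrafilters X"
    unfolding coarse_ultrafilters_def using prime by simp
  have "close_sets X C D" if "C \<in> F" "D \<in> G" for C D
    using that close[OF _ order_refl] unfolding G_def by blast
  with F G have "(F, G) \<in> alike X" unfolding alike_def by simp
  then have "G \<in> p"
    using p in_quotient_imp_closed[OF equiv_alike] unfolding corona_points_def by blast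
  moreover have "B \<in> G" using p assms unfolding G_def by blast
  ultimately show "p \<in> corona_cl X B" using p unfolding corona_cl_def by blast
qed

lemma corona_farI:
  assumes "A \<subseteq> mspace X" "B \<subseteq> mspace X" "coarsely_disjoint X A B"
    "P \<subseteq> corona_cl X A" "Q \<subseteq> corona_cl X B"
  shows "corona_far X P Q"
  unfolding corona_far_def by (intro exI[of _ A] exI[of _ B] conjI assms)

lemma corona_farE:
  assumes "corona_far X P Q"
  obtains A B where "A \<subseteq> mspace X" "B \<subseteq> mspace X" "coarsely_disjoint X A B"
    "P \<subseteq> corona_cl X A" "Q \<subseteq> corona_cl X B"
  using assms unfolding corona_far_def by (elim exE conjE)

lemma corona_far_point_iff:
  assumes p: "p \<in> corona_points X"
  shows "corona_far X {p} P \<longleftrightarrow>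
    (\<exists>B C. B \<subseteq> mspace X \<and> C \<subseteq> mspace X \<and> P \<subseteq> corona_cl X B \<and> p \<notin> corona_cl X C \<and>
      coarsely_disjoint X B (mspace X - C))"
proof
  assume "corona_far X {p} P"
  then obtain A B where AB: "A \<subseteq> mspace X" "B \<subseteq> mspace X" "coarsely_disjoint X A B"
    "{p} \<subseteq> corona_cl X A" "P \<subseteq> corona_cl X B" by (rule corona_farE)
  obtain C D where CD: "C \<union> D = mspace X" "coarsely_disjoint X A C" "coarsely_disjoint X B D"
    using AB(3) by (rule coarsely_disjoint_separation)
  have "p \<notin> corona_cl X C" using corona_cl_disjoint[OF CD(2)] AB(4) by auto
  moreover have "mspace X - C \<subseteq> D" using CD(1) by auto
  then have "coarsely_disjoint X B (mspace X - C)"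
    using coarsely_disjoint_mono[OF CD(3)] by simp
  moreover have "C \<subseteq> mspace X" using CD(1) by auto
  ultimately show "\<exists>B C. B \<subseteq> mspace X \<and> C \<subseteq> mspace X \<and> P \<subseteq> corona_cl X B \<and>
      p \<notin> corona_cl X C \<and> coarsely_disjoint X B (mspace X - C)"
    using AB(2,5) by metis
next
  assume "\<exists>B C. B \<subseteq> mspace X \<and> C \<subseteq> mspace X \<and> P \<subseteq> corona_cl X B \<and> p \<notin> corona_cl X C \<and>
      coarsely_disjoint X B (mspace X - C)"
  then obtain B C where BC: "B \<subseteq> mspace X" "C \<subseteq> mspace X" "P \<subseteq> corona_cl X B"
    "p \<notin> corona_cl X C" "coarsely_disjoint X B (mspace X - C)" by (elim exE conjE)
  have "p \<in> corona_cl X (mspace X - C)"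
    using corona_cl_Un_mspace[OF p, of C "mspace X - C"] BC(2,4) by (simp add: Un_absorb1)
  then show "corona_far X {p} P"
    using BC coarsely_disjoint_sym[OF BC(5)] by (intro corona_farI[of "mspace X - C" X B]) simp_all
qed

lemma corona_cl_Un:
  assumes "A \<subseteq> mspace X" "B \<subseteq> mspace X"
  shows "corona_cl X (A \<union> B) = corona_cl X A \<union> corona_cl X B"
proof
  show "corona_cl X (A \<union> B) \<subseteq> corona_cl X A \<union> corona_cl X B"
  proof
    fix p assume "p \<in> corona_cl X (A \<union> B)"
    then obtain F where p: "p \<in> corona_points X" "F \<in> p" "A \<union> B \<in> F"
      unfolding corona_cl_def by auto
    have "F \<in> coarse_ultrafilters X"
      using p in_quotient_imp_subset[OF equiv_alike] unfolding corona_points_def by blast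
    then have "A \<in> F \<or> B \<in> F" using coarse_ultrafilterD(3) p(3) by metis
    with p(1,2) show "p \<in> corona_cl X A \<union> corona_cl X B" unfolding corona_cl_def by auto
  qed
  show "corona_cl X A \<union> corona_cl X B \<subseteq> corona_cl X (A \<union> B)"
    using assms by (intro Un_least corona_cl_mono) simp_all
qed

lemma corona_far_point_Un:
  assumes p: "p \<in> corona_points X"
    and far: "corona_far X {p} P" "corona_far X {p} Q"
  shows "corona_far X {p} (P \<union> Q)"
proof -
  obtain B C where BC: "B \<subseteq> mspace X" "C \<subseteq> mspace X" "P \<subseteq> corona_cl X B"
    "p \<notin> corona_cl X C" "coarsely_disjoint X B (mspace X - C)"
    using far(1) unfolding corona_far_point_iff[OF p] by (elim exE conjE)
  obtain B' C' where BC': "B' \<subseteq> mspace X" "C' \<subseteq> mspace X" "Q \<subseteq> corona_cl X B'"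
    "p \<notin> corona_cl X C'" "coarsely_disjoint X B' (mspace X - C')"
    using far(2) unfolding corona_far_point_iff[OF p] by (elim exE conjE)
  let ?D = "mspace X - (C \<union> C')"
  have "coarsely_disjoint X ?D B"
    using coarsely_disjoint_sym[OF BC(5)] by (rule coarsely_disjoint_mono) auto
  moreover have "coarsely_disjoint X ?D B'"
    using coarsely_disjoint_sym[OF BC'(5)] by (rule coarsely_disjoint_mono) auto
  ultimately have "coarsely_disjoint X (B \<union> B') ?D"
    by (intro coarsely_disjoint_sym[OF coarsely_disjoint_Un])
  moreover have "p \<notin> corona_cl X (C \<union> C')"
    using corona_cl_Un[OF BC(2) BC'(2)] BC(4) BC'(4) by simp
  moreover have "P \<union> Q \<subseteq> corona_cl X (B \<union> B')"
    using corona_cl_Un[OF BC(1) BC'(1)] BC(3) BC'(3) by auto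
  moreover have "B \<union> B' \<subseteq> mspace X" "C \<union> C' \<subseteq> mspace X"
    using BC(1,2) BC'(1,2) by simp_all
  ultimately show ?thesis unfolding corona_far_point_iff[OF p] by metis
qed

lemma corona_far_antimono: "corona_far X P Q \<Longrightarrow> Q' \<subseteq> Q \<Longrightarrow> corona_far X P Q'"
  by (erule corona_farE, erule corona_farI) (assumption+, erule (1) order_trans)

lemma corona_far_point_notin:
  assumes "corona_far X {p} P"
  shows "p \<notin> P"
proof -
  obtain A B where "coarsely_disjoint X A B" "{p} \<subseteq> corona_cl X A" "P \<subseteq> corona_cl X B"
    using assms by (rule corona_farE)
  then show ?thesis using corona_cl_disjoint[of X A B] by auto
qed

lemma corona_far_empty:
  assumes "p \<in> corona_points X"
  shows "corona_far X {p} {}"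
proof -
  have "p \<in> corona_cl X (mspace X)" using corona_cl_Un_mspace[OF assms, of "mspace X"] by auto
  moreover have "coarsely_disjoint X (mspace X) {}"
    unfolding coarsely_disjoint_iff by (simp add: both_near_def bounded_in_iff)
  ultimately show ?thesis
    by (intro corona_farI[of "mspace X" X "{}"]) simp_all
qed

lemma istopology_corona:
  "istopology (\<lambda>U. U \<subseteq> corona_points X \<and>
    (\<forall>p\<in>corona_points X. corona_close X {p} (corona_points X - U) \<longrightarrow> p \<notin> U))"
  unfolding istopology_def
proof (intro conjI allI impI)
  fix U V :: "'a set set set set"
  assume U: "U \<subseteq> corona_points X \<and>
      (\<forall>p\<in>corona_points X. corona_close X {p} (corona_points X - U) \<longrightarrow> p \<notin> U)"
    and V: "V \<subseteq> corona_points X \<and>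
      (\<forall>p\<in>corona_points X. corona_close X {p} (corona_points X - V) \<longrightarrow> p \<notin> V)"
  show "U \<inter> V \<subseteq> corona_points X" using U by blast
  have "corona_far X {p} (corona_points X - U \<inter> V)" if "p \<in> U \<inter> V" for p
  proof -
    have "p \<in> corona_points X" "corona_far X {p} (corona_points X - U)"
      "corona_far X {p} (corona_points X - V)" using that U V by auto
    then show ?thesis using corona_far_point_Un[of p X] by (simp add: Diff_Int)
  qed
  then show "\<forall>p\<in>corona_points X. corona_close X {p} (corona_points X - U \<inter> V) \<longrightarrow> p \<notin> U \<inter> V"
    by auto
next
  fix \<U> :: "'a set set set set set"
  assume \<U>: "\<forall>U\<in>\<U>. U \<subseteq> corona_points X \<and>
      (\<forall>p\<in>corona_points X. corona_close X {p} (corona_points X - U) \<longrightarrow> p \<notin> U)"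
  then show "\<Union>\<U> \<subseteq> corona_points X" by blast
  have "corona_far X {p} (corona_points X - \<Union>\<U>)" if "U \<in> \<U>" "p \<in> U" for p U
  proof (rule corona_far_antimono)
    show "corona_far X {p} (corona_points X - U)" using that \<U> by auto
    show "corona_points X - \<Union>\<U> \<subseteq> corona_points X - U" using that by auto
  qed
  then show "\<forall>p\<in>corona_points X. corona_close X {p} (corona_points X - \<Union>\<U>) \<longrightarrow> p \<notin> \<Union>\<U>"
    by auto
qed

lemma openin_corona:
  "openin (corona X) U \<longleftrightarrow> U \<subseteq> corona_points X \<and>
    (\<forall>p\<in>corona_points X. corona_close X {p} (corona_points X - U) \<longrightarrow> p \<notin> U)"
  unfolding corona_def topology_inverse'[OF istopology_corona] ..

lemma topspace_corona: "topspace (corona X) = corona_points X"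
proof -
  have "openin (corona X) (corona_points X)"
    unfolding openin_corona by (auto simp: corona_far_empty)
  then show ?thesis
    by (meson openin_corona openin_subset openin_topspace subset_antisym)
qed

lemma closure_of_corona:
  assumes P: "P \<subseteq> corona_points X"
  shows "corona X closure_of P = {p \<in> corona_points X. corona_close X {p} P}" (is "_ = ?K")
proof
  show "?K \<subseteq> corona X closure_of P"
  proof
    fix p assume p: "p \<in> ?K"
    have "\<exists>y\<in>P. y \<in> T" if T: "p \<in> T" "openin (corona X) T" for T
    proof (rule ccontr)
      assume "\<not> (\<exists>y\<in>P. y \<in> T)"
      then have "P \<subseteq> corona_points X - T" using P by auto
      moreover have "corona_far X {p} (corona_points X - T)"
        using T p unfolding openin_corona by auto
      ultimately have "corona_far X {p} P" using corona_far_antimono by metis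
      with p show False by simp
    qed
    with p show "p \<in> corona X closure_of P" unfolding in_closure_of topspace_corona by auto
  qed
  have "corona_far X {p} ?K" if p: "p \<in> corona_points X" "corona_far X {p} P" for p
  proof -
    obtain A B where AB: "A \<subseteq> mspace X" "B \<subseteq> mspace X" "coarsely_disjoint X A B"
      "{p} \<subseteq> corona_cl X A" "P \<subseteq> corona_cl X B" using p(2) by (rule corona_farE)
    obtain C D where CD: "C \<union> D = mspace X" "coarsely_disjoint X A C" "coarsely_disjoint X B D"
      using AB(3) by (rule coarsely_disjoint_separation)
    have CDX: "C \<subseteq> mspace X" "D \<subseteq> mspace X" using CD by auto
    have "q \<in> corona_cl X C" if q: "q \<in> ?K" for q
    proof (rule ccontr)
      assume "q \<notin> corona_cl X C"
      then have "q \<in> corona_cl X D" using corona_cl_Un_mspace[OF _ CD(1)] q by auto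
      then have "corona_far X {q} P"
        using AB(2,5) CDX coarsely_disjoint_sym[OF CD(3)]
        by (intro corona_farI[of D X B]) simp_all
      with q show False by simp
    qed
    then have "?K \<subseteq> corona_cl X C" by blast
    with AB(1,4) CD(2) CDX(1) show ?thesis by (intro corona_farI[of A X C])
  qed
  then have op: "openin (corona X) (corona_points X - ?K)"
    unfolding openin_corona by (auto simp: double_diff)
  show "corona X closure_of P \<subseteq> ?K"
  proof (rule closure_of_minimal)
    show "P \<subseteq> ?K" using P corona_far_point_notin[of X _ P] by auto
    show "closedin (corona X) ?K" unfolding closedin_def topspace_corona using op by auto
  qed
qed

end

theory Submission
  imports Defs
begin

text \<open>For compactness, take an open cover without finite subcover. The sets \<open>S\<close> whose
  \<open>corona_cl X S\<close> is finitely covered form an ideal that contains the bounded sets but not the whole space. Outside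
  a prime ideal extending it lies a coarse ultrafilter, because coarsely disjoint sets have
  bounded intersection. The cover member around its class contains \<open>corona_cl X D\<close> for some \<open>D\<close>
  of this ultrafilter, so \<open>D\<close> is in the ideal after all.

  For functoriality, preimages of coarsely disjoint sets under two close coarse maps are coarsely
  disjoint. This makes push-forward well defined on classes and proximally continuous.\<close>

section \<open>Coarse maps\<close>

lemma coarse_mapD:
  assumes "f \<in> coarse_maps X Y"
  shows "x \<in> mspace X \<Longrightarrow> f x \<in> mspace Y"
    and "entourage X E \<Longrightarrow> entourage Y (map_prod f f ` E)"
    and "bounded_in Y B \<Longrightarrow> bounded_in X (f -` B \<inter> mspace X)"
  using assms unfolding coarse_maps_def by auto

text \<open>The pairs at distance at most \<open>r\<close> form one entourage, so a bound on its
  image is uniform: \<open>R\<close> depends on \<open>r\<close> but not on the points.\<close>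

lemma coarse_map_bornologous:
  assumes "f \<in> coarse_maps X Y"
  obtains R where
    "\<And>x y. x \<in> mspace X \<Longrightarrow> y \<in> mspace X \<Longrightarrow> mdist X x y \<le> r \<Longrightarrow> mdist Y (f x) (f y) \<le> R"
proof -
  let ?E = "{(x, y). x \<in> mspace X \<and> y \<in> mspace X \<and> mdist X x y \<le> r}"
  have "entourage X ?E" unfolding entourage_def bdd_above_def by auto
  then have "entourage Y (map_prod f f ` ?E)" using assms by (rule coarse_mapD(2)[rotated])
  then obtain R where "\<forall>u\<in>(\<lambda>(x, y). mdist Y x y) ` map_prod f f ` ?E. u \<le> R"
    unfolding entourage_def bdd_above_def by blast
  then have "mdist Y (f x) (f y) \<le> R"
    if "x \<in> mspace X" "y \<in> mspace X" "mdist X x y \<le> r" for x y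
    using that by (fastforce simp: image_image)
  then show thesis by (rule that)
qed

lemma id_coarse_map: "id \<in> coarse_maps X X"
  unfolding coarse_maps_def by (auto simp: map_prod.id intro: bounded_in_subset)

lemma comp_coarse_map:
  assumes f: "f \<in> coarse_maps X Y" and g: "g \<in> coarse_maps Y Z"
  shows "g \<circ> f \<in> coarse_maps X Z"
proof -
  have "entourage Z (map_prod (g \<circ> f) (g \<circ> f) ` E)" if "entourage X E" for E
    using coarse_mapD(2)[OF g coarse_mapD(2)[OF f that]] by (simp add: image_comp map_prod.comp)
  moreover have "bounded_in X ((g \<circ> f) -` B \<inter> mspace X)" if "bounded_in Z B" for B
  proof -
    have "(g \<circ> f) -` B \<inter> mspace X = f -` (g -` B \<inter> mspace Y) \<inter> mspace X"
      using coarse_mapD(1)[OF f] by auto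
    then show ?thesis using coarse_mapD(3)[OF f coarse_mapD(3)[OF g that]] by simp
  qed
  ultimately show ?thesis
    unfolding coarse_maps_def[of X Z] using coarse_mapD(1)[OF f] coarse_mapD(1)[OF g] by simp
qed

lemma close_maps_iff:
  "(f, g) \<in> close_maps X Y \<longleftrightarrow> f \<in> coarse_maps X Y \<and> g \<in> coarse_maps X Y \<and>
    (\<exists>R. \<forall>x\<in>mspace X. mdist Y (f x) (g x) \<le> R)"
  unfolding close_maps_def entourage_def bdd_above_def
  by (auto dest: coarse_mapD(1))

lemma equiv_close_maps: "equiv (coarse_maps X Y) (close_maps X Y)"
proof (rule equivI)
  show "close_maps X Y \<subseteq> coarse_maps X Y \<times> coarse_maps X Y"
    unfolding close_maps_def by auto
  show "refl_on (coarse_maps X Y) (close_maps X Y)"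
    unfolding refl_on_def close_maps_iff 
    by (auto simp: coarse_mapD(1) intro!: exI[of _ 0] eq_refl)
  show "sym (close_maps X Y)"
    by (rule symI) (auto simp: close_maps_iff mdist_commute)
  show "trans (close_maps X Y)"
  proof (rule transI)
    fix f g h assume "(f, g) \<in> close_maps X Y" "(g, h) \<in> close_maps X Y"
    then obtain R S where fgh: "f \<in> coarse_maps X Y" "g \<in> coarse_maps X Y" "h \<in> coarse_maps X Y"
      and R: "\<forall>x\<in>mspace X. mdist Y (f x) (g x) \<le> R"
      and S: "\<forall>x\<in>mspace X. mdist Y (g x) (h x) \<le> S"
      unfolding close_maps_iff by blast
    have "mdist Y (f x) (h x) \<le> R + S" if x: "x \<in> mspace X" for x
      using mdist_triangle[of "f x" Y "g x" "h x"] fgh[THEN coarse_mapD(1), OF x]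
        bspec[OF R x] bspec[OF S x] by linarith
    then show "(f, h) \<in> close_maps X Y" using fgh unfolding close_maps_iff by blast
  qed
qed

text \<open>Go from \<open>g (f x)\<close> to \<open>g' (f' x)\<close> through
  \<open>g (f' x)\<close>. The first leg is bounded because \<open>g\<close> carries pairs at
  distance at most \<open>R\<close> to pairs at bounded distance, the second because
  \<open>g\<close> and \<open>g'\<close> are close.\<close>

lemma comp_close_maps:
  assumes ff: "(f, f') \<in> close_maps X Y" and gg: "(g, g') \<in> close_maps Y Z"
  shows "(g \<circ> f, g' \<circ> f') \<in> close_maps X Z"
proof -
  obtain R where f: "f \<in> coarse_maps X Y" "f' \<in> coarse_maps X Y"
    and R: "\<forall>x\<in>mspace X. mdist Y (f x) (f' x) \<le> R" using ff unfolding close_maps_iff by blast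
  obtain S where g: "g \<in> coarse_maps Y Z" "g' \<in> coarse_maps Y Z"
    and S: "\<forall>x\<in>mspace Y. mdist Z (g x) (g' x) \<le> S" using gg unfolding close_maps_iff by blast
  obtain T where T: "\<And>x y. x \<in> mspace Y \<Longrightarrow> y \<in> mspace Y \<Longrightarrow> mdist Y x y \<le> R \<Longrightarrow>
      mdist Z (g x) (g y) \<le> T"
    using coarse_map_bornologous[OF g(1), of R] by blast
  have "mdist Z (g (f x)) (g' (f' x)) \<le> T + S" if x: "x \<in> mspace X" for x
  proof -
    have fx: "f x \<in> mspace Y" "f' x \<in> mspace Y" using coarse_mapD(1) f x by metis+
    have "mdist Z (g (f x)) (g' (f' x)) \<le> mdist Z (g (f x)) (g (f' x)) + mdist Z (g (f' x)) (g' (f' x))"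
      using coarse_mapD(1) fx g by (metis mdist_triangle)
    also have "\<dots> \<le> T + S" using T[OF fx] fx x R S by (intro add_mono) auto
    finally show ?thesis .
  qed
  then show ?thesis unfolding close_maps_iff using f g comp_coarse_map by fastforce
qed

section \<open>The category of metric spaces and coarse maps modulo closeness\<close>

lemma cmp_mCoarse_class:
  assumes "f \<in> coarse_maps X Y" "g \<in> coarse_maps Y Z"
  shows "cmp mCoarse X Y Z (close_maps Y Z `` {g}) (close_maps X Y `` {f}) =
    close_maps X Z `` {g \<circ> f}"
proof -
  \<comment> \<open>The unions in \<open>cmp\<close> run over equal classes, so composition can be
    computed on any representatives. The category laws thereby become laws for maps.\<close>
  have "congruent2 (close_maps Y Z) (close_maps X Y) (\<lambda>g f. close_maps X Z `` {g \<circ> f})"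
    by (intro congruent2I' equiv_class_eq[OF equiv_close_maps] comp_close_maps)
  then show ?thesis
    unfolding mCoarse_def
    using UN_equiv_class2[OF equiv_close_maps equiv_close_maps _ assms(2,1)] by simp
qed

lemma Hom_mCoarseE:
  assumes "F \<in> Hom mCoarse X Y"
  obtains f where "f \<in> coarse_maps X Y" "F = close_maps X Y `` {f}"
  using assms unfolding mCoarse_def by (auto elim: quotientE)

lemma Hom_mCoarseI: "f \<in> coarse_maps X Y \<Longrightarrow> close_maps X Y `` {f} \<in> Hom mCoarse X Y"
  unfolding mCoarse_def by (simp add: quotientI)

lemma ident_mCoarse: "ident mCoarse X = close_maps X X `` {id}"
  unfolding mCoarse_def by simp

lemma category_mCoarse: "category mCoarse"
proof
  fix X :: "'a metric"
  show "ident mCoarse X \<in> Hom mCoarse X X"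
    unfolding ident_mCoarse by (intro Hom_mCoarseI id_coarse_map)
next
  fix X Y Z :: "'a metric" and F G assume "F \<in> Hom mCoarse X Y" "G \<in> Hom mCoarse Y Z"
  then show "cmp mCoarse X Y Z G F \<in> Hom mCoarse X Z"
    by (elim Hom_mCoarseE) (simp add: cmp_mCoarse_class Hom_mCoarseI comp_coarse_map)
next
  fix X Y :: "'a metric" and F assume "F \<in> Hom mCoarse X Y"
  then obtain f where "f \<in> coarse_maps X Y" "F = close_maps X Y `` {f}" by (rule Hom_mCoarseE)
  then show "cmp mCoarse X Y Y (ident mCoarse Y) F = F" "cmp mCoarse X X Y F (ident mCoarse X) = F"
    by (simp_all add: ident_mCoarse cmp_mCoarse_class id_coarse_map)
next
  fix W X Y Z :: "'a metric" and F G H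
  assume "F \<in> Hom mCoarse W X" "G \<in> Hom mCoarse X Y" "H \<in> Hom mCoarse Y Z"
  then show "cmp mCoarse W X Z (cmp mCoarse X Y Z H G) F =
      cmp mCoarse W Y Z H (cmp mCoarse W X Y G F)"
    by (elim Hom_mCoarseE) (simp add: cmp_mCoarse_class comp_coarse_map comp_assoc)
qed

section \<open>The category of topological spaces\<close>

lemma category_Top: "category Top"
proof
  show "ident Top S \<in> Hom Top S S" for S :: "'a topology"
    unfolding Top_def by (simp add: continuous_map_eq[OF continuous_map_id])
  show "cmp Top S T U g f \<in> Hom Top S U" if "f \<in> Hom Top S T" "g \<in> Hom Top T U"
    for S T U :: "'a topology" and f g
  proof -
    have "continuous_map S U (g \<circ> f)"
      using that unfolding Top_def by (auto intro: continuous_map_compose)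
    then have "continuous_map S U (compose (topspace S) g f)"
      by (rule continuous_map_eq) (simp add: compose_def)
    then show ?thesis unfolding Top_def by (simp add: compose_def)
  qed
next
  fix S T :: "'a topology" and f assume "f \<in> Hom Top S T"
  then have f: "f \<in> extensional (topspace S)" "f \<in> topspace S \<rightarrow> topspace T"
    unfolding Top_def by (auto dest: continuous_map_funspace)
  \<comment> \<open>In the left law \<open>restrict id\<close> acts as the identity because
    \<open>f\<close> lands in \<open>topspace T\<close>. Off \<open>topspace S\<close> both laws
    rest on the extensionality of \<open>f\<close>.\<close>
  show "cmp Top S T T (ident Top T) f = f" and "cmp Top S S T f (ident Top S) = f"
    using f unfolding Top_def by (auto simp: compose_def extensional_def fun_eq_iff)
next
  fix R S T U :: "'a topology" and f g h
  assume "f \<in> Hom Top R S"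
  then have "f \<in> topspace R \<rightarrow> topspace S"
    unfolding Top_def by (auto dest: continuous_map_funspace)
  \<comment> \<open>The restriction to \<open>topspace S\<close> inside
    \<open>cmp Top S T U h g\<close> is invisible at \<open>f x\<close>, since \<open>f\<close>
    lands in \<open>topspace S\<close>.\<close>
  then show "cmp Top R S U (cmp Top S T U h g) f = cmp Top R T U h (cmp Top R S T g f)"
    unfolding Top_def by (auto simp: compose_def fun_eq_iff)
qed

section \<open>Push-forward of coarse ultrafilters\<close>

text \<open>If \<open>z\<close> is near points \<open>a\<close> and \<open>b\<close> with
  \<open>f a\<close> in \<open>A\<close> and \<open>g b\<close> in \<open>B\<close>, then
  \<open>f z\<close> is near \<open>f a\<close>, and near \<open>g b\<close> by way of
  \<open>f b\<close>. So \<open>f z\<close> lies in a bounded set, and preimages of bounded sets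
  under \<open>f\<close> are bounded. Allowing two maps yields independence of the representative of
  a closeness class as well.\<close>

lemma coarsely_disjoint_vimage:
  assumes fg: "(f, g) \<in> close_maps X Y" and AB: "coarsely_disjoint Y A B"
  shows "coarsely_disjoint X (f -` A) (g -` B)"
  unfolding coarsely_disjoint_iff
proof
  fix r
  obtain R where f: "f \<in> coarse_maps X Y" and g: "g \<in> coarse_maps X Y"
    and R: "\<forall>x\<in>mspace X. mdist Y (f x) (g x) \<le> R" using fg unfolding close_maps_iff by blast
  obtain S where S: "\<And>x y. x \<in> mspace X \<Longrightarrow> y \<in> mspace X \<Longrightarrow> mdist X x y \<le> r \<Longrightarrow>
      mdist Y (f x) (f y) \<le> S" using coarse_map_bornologous[OF f, of r] by blast
  \<comment> \<open>\<open>S\<close> bounds the distance from \<open>f z\<close> to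
    \<open>f a\<close>, and \<open>S + R\<close> the distance to \<open>g b\<close>. With
    \<open>max R 0\<close> one radius covers both without a sign condition on
    \<open>R\<close>.\<close>
  let ?s = "S + max R 0"
  have "both_near X r (f -` A) (g -` B) \<subseteq> f -` both_near Y ?s A B \<inter> mspace X"
  proof
    fix z assume "z \<in> both_near X r (f -` A) (g -` B)"
    then obtain a b where z: "z \<in> mspace X" and a: "a \<in> mspace X" "f a \<in> A" "mdist X z a \<le> r"
      and b: "b \<in> mspace X" "g b \<in> B" "mdist X z b \<le> r" unfolding both_near_def by auto
    have Y: "f z \<in> mspace Y" "f a \<in> mspace Y" "f b \<in> mspace Y" "g b \<in> mspace Y"
      using coarse_mapD(1) f g z a b by metis+
    have "mdist Y (f z) (g b) \<le> ?s"
      using mdist_triangle[OF Y(1,3,4)] S[OF z b(1,3)] bspec[OF R b(1)] by linarith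
    moreover have "mdist Y (f z) (f a) \<le> ?s" using S[OF z a(1,3)] by linarith
    ultimately show "z \<in> f -` both_near Y ?s A B \<inter> mspace X"
      using z a(2) b(2) Y unfolding both_near_def by auto
  qed
  moreover have "bounded_in Y (both_near Y ?s A B)" using AB unfolding coarsely_disjoint_iff ..
  ultimately show "bounded_in X (both_near X r (f -` A) (g -` B))"
    using coarse_mapD(3)[OF f] bounded_in_subset by blast
qed

text \<open>Varying map and ultrafilter together serves two ends: equal arguments give the closeness
  axiom for a push-forward, and different ones show that the class of the push-forward depends on
  classes only.\<close>

lemma pushforward_close:
  assumes FG: "(F, G) \<in> alike X" and fg: "(f, g) \<in> close_maps X Y"
    and A: "A \<in> pushforward X Y f F" and B: "B \<in> pushforward X Y g G"
  shows "close_sets Y A B"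
proof
  assume "coarsely_disjoint Y A B"
  then have "coarsely_disjoint X (f -` A \<inter> mspace X) (g -` B \<inter> mspace X)"
    using coarsely_disjoint_mono[OF coarsely_disjoint_vimage[OF fg]] by blast
  then show False using FG A B unfolding alike_def pushforward_def by blast
qed

lemma pushforward_coarse_ultrafilter:
  assumes F: "F \<in> coarse_ultrafilters X" and f: "f \<in> coarse_maps X Y"
  shows "pushforward X Y f F \<in> coarse_ultrafilters Y"
proof -
  have FF: "(F, F) \<in> alike X" and ff: "(f, f) \<in> close_maps X Y"
    using equiv_class_self[OF equiv_alike F] equiv_class_self[OF equiv_close_maps f] by simp_all
  have "f -` mspace Y \<inter> mspace X = mspace X" using coarse_mapD(1)[OF f] by auto
  then have "mspace Y \<in> pushforward X Y f F"
    using coarse_ultrafilterD(4)[OF F] unfolding pushforward_def by simp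
  moreover have "close_sets Y A B"
    if "A \<in> pushforward X Y f F" "B \<in> pushforward X Y f F" for A B
    using pushforward_close[OF FF ff that] .
  moreover have "A \<in> pushforward X Y f F \<or> B \<in> pushforward X Y f F"
    if "A \<subseteq> mspace Y" "B \<subseteq> mspace Y" "A \<union> B \<in> pushforward X Y f F" for A B
    using that coarse_ultrafilterD(3)[OF F, of "f -` A \<inter> mspace X" "f -` B \<inter> mspace X"]
    unfolding pushforward_def by (simp add: Int_Un_distrib2)
  ultimately show ?thesis
    unfolding coarse_ultrafilters_def[of Y] by (auto simp: pushforward_def)
qed

lemma pushforward_alike:
  assumes FG: "(F, G) \<in> alike X" and fg: "(f, g) \<in> close_maps X Y"
  shows "(pushforward X Y f F, pushforward X Y g G) \<in> alike Y"
proof -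
  have "F \<in> coarse_ultrafilters X" "G \<in> coarse_ultrafilters X"
    "f \<in> coarse_maps X Y" "g \<in> coarse_maps X Y"
    using FG fg unfolding alike_def close_maps_def by auto
  then show ?thesis
    unfolding alike_def[of Y] using pushforward_close[OF assms]
    by (simp add: pushforward_coarse_ultrafilter)
qed

lemma pushforward_id: "F \<in> coarse_ultrafilters X \<Longrightarrow> pushforward X X id F = F"
  unfolding pushforward_def using coarse_ultrafilterD(1)[of F X] by (auto simp: Int_absorb2)

lemma pushforward_comp:
  assumes "f \<in> coarse_maps X Y" "g \<in> coarse_maps Y Z"
  shows "pushforward X Z (g \<circ> f) F = pushforward Y Z g (pushforward X Y f F)"
proof -
  have "(g \<circ> f) -` A \<inter> mspace X = f -` (g -` A \<inter> mspace Y) \<inter> mspace X" for A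
    using coarse_mapD(1)[OF assms(1)] by auto
  then show ?thesis unfolding pushforward_def by simp
qed

section \<open>The induced maps of coronas\<close>

lemma corona_pointE:
  assumes "p \<in> corona_points X"
  obtains F where "F \<in> coarse_ultrafilters X" "p = alike X `` {F}"
  using assms unfolding corona_points_def by (auto elim: quotientE)

lemma corona_pointI: "F \<in> coarse_ultrafilters X \<Longrightarrow> alike X `` {F} \<in> corona_points X"
  unfolding corona_points_def by (rule quotientI)

lemma corona_clI:
  assumes "F \<in> coarse_ultrafilters X" "A \<in> F"
  shows "alike X `` {F} \<in> corona_cl X A"
  unfolding corona_cl_def
  using assms equiv_class_self[OF equiv_alike assms(1)] corona_pointI by blast

text \<open>The nested unions over the closeness class and the corona point are over equal classes,
  because push-forward respects both equivalences at once. All later reasoning about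
  \<open>corona_hom\<close> goes through this formula on representatives.\<close>

lemma corona_hom_class:
  assumes F: "F \<in> coarse_ultrafilters X" and f: "f \<in> coarse_maps X Y"
  shows "corona_hom X Y (close_maps X Y `` {f}) (alike X `` {F}) =
    alike Y `` {pushforward X Y f F}"
proof -
  have "congruent2 (close_maps X Y) (alike X) (\<lambda>f F. alike Y `` {pushforward X Y f F})"
    by (intro congruent2I' equiv_class_eq[OF equiv_alike] pushforward_alike)
  then show ?thesis
    unfolding corona_hom_def corona_map_def
    using UN_equiv_class2[OF equiv_close_maps equiv_alike _ f F] corona_pointI[OF F] by simp
qed

lemma corona_hom_in_corona_points:
  assumes "p \<in> corona_points X" "f \<in> coarse_maps X Y"
  shows "corona_hom X Y (close_maps X Y `` {f}) p \<in> corona_points Y"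
  using assms
  by (auto elim!: corona_pointE simp: corona_hom_class
      intro!: corona_pointI pushforward_coarse_ultrafilter)

lemma corona_hom_extensional: "corona_hom X Y \<Phi> \<in> extensional (corona_points X)"
  unfolding corona_hom_def by simp

section \<open>Proximal continuity and continuity\<close>

lemma corona_cl_vimage:
  assumes p: "p \<in> corona_points X" and f: "f \<in> coarse_maps X Y"
    and cl: "corona_hom X Y (close_maps X Y `` {f}) p \<in> corona_cl Y A"
    and AC: "coarsely_disjoint Y A C" and CD: "C \<union> D = mspace Y"
  shows "p \<in> corona_cl X (f -` D \<inter> mspace X)"
proof -
  obtain F where F: "F \<in> coarse_ultrafilters X" "p = alike X `` {F}" using p by (rule corona_pointE)
  let ?G = "pushforward X Y f F"
  have G: "?G \<in> coarse_ultrafilters Y" using F(1) f by (rule pushforward_coarse_ultrafilter)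
  \<comment> \<open>The hypothesis \<open>cl\<close> only puts \<open>A\<close> into some
    ultrafilter alike to \<open>?G\<close>, so \<open>A\<close> itself may be missing from
    \<open>?G\<close>. Its coarse neighbourhood \<open>D\<close> is not: \<open>C\<close> is
    coarsely disjoint from \<open>A\<close>, hence not in \<open>?G\<close>, and the union axiom
    leaves \<open>D\<close>.\<close>
  have "C \<notin> ?G"
    using corona_clI[OF G] corona_cl_disjoint[OF AC] cl F f by (auto simp: corona_hom_class)
  then have "D \<in> ?G" using coarse_ultrafilterD(3,4)[OF G] CD by metis
  then show ?thesis
    unfolding F(2) by (intro corona_clI F(1)) (simp add: pushforward_def)
qed

text \<open>Witnesses of farness in \<open>Y\<close> are enlarged to coarse neighbourhoods that are
  still coarsely disjoint. Their preimages then witness farness in \<open>X\<close>.\<close>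

lemma corona_far_vimage:
  assumes f: "f \<in> coarse_maps X Y" and PQ: "P \<subseteq> corona_points X" "Q \<subseteq> corona_points X"
    and far: "corona_far Y (corona_hom X Y (close_maps X Y `` {f}) ` P)
      (corona_hom X Y (close_maps X Y `` {f}) ` Q)"
  shows "corona_far X P Q"
proof -
  obtain A B where AB: "coarsely_disjoint Y A B"
    "corona_hom X Y (close_maps X Y `` {f}) ` P \<subseteq> corona_cl Y A"
    "corona_hom X Y (close_maps X Y `` {f}) ` Q \<subseteq> corona_cl Y B"
    using far by (rule corona_farE)
  \<comment> \<open>The first separation gives a neighbourhood \<open>D\<close> of \<open>A\<close>
    coarsely disjoint from \<open>B\<close>. The second, applied to \<open>B\<close> and
    \<open>D\<close>, gives a neighbourhood \<open>D'\<close> of \<open>B\<close> coarsely disjoint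
    from \<open>D\<close>.\<close>
  obtain C D where CD: "C \<union> D = mspace Y" "coarsely_disjoint Y A C" "coarsely_disjoint Y B D"
    using AB(1) by (rule coarsely_disjoint_separation)
  obtain C' D' where CD': "C' \<union> D' = mspace Y" "coarsely_disjoint Y B C'"
    "coarsely_disjoint Y D D'" using CD(3) by (rule coarsely_disjoint_separation)
  have "(f, f) \<in> close_maps X Y" using equiv_class_self[OF equiv_close_maps f] by simp
  then have "coarsely_disjoint X (f -` D) (f -` D')"
    using CD'(3) by (rule coarsely_disjoint_vimage)
  then have "coarsely_disjoint X (f -` D \<inter> mspace X) (f -` D' \<inter> mspace X)"
    by (rule coarsely_disjoint_mono) auto
  then show ?thesis
  proof (rule corona_farI[rotated 2])
    show "P \<subseteq> corona_cl X (f -` D \<inter> mspace X)"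
      using corona_cl_vimage[OF _ f _ CD(2,1)] AB(2) PQ(1) by blast
    show "Q \<subseteq> corona_cl X (f -` D' \<inter> mspace X)"
      using corona_cl_vimage[OF _ f _ CD'(2,1)] AB(3) PQ(2) by blast
  qed auto
qed

text \<open>The map sends the complement of the preimage of \<open>U\<close> into the complement of
  \<open>U\<close>. The image of a point of the preimage is far from the latter, and farness pulls
  back along the map.\<close>

lemma continuous_map_corona_hom:
  assumes f: "f \<in> coarse_maps X Y"
  shows "continuous_map (corona X) (corona Y) (corona_hom X Y (close_maps X Y `` {f}))"
    (is "continuous_map _ _ ?h")
  unfolding continuous_map_def topspace_corona
proof (intro conjI allI impI)
  show "?h \<in> corona_points X \<rightarrow> corona_points Y" using corona_hom_in_corona_points[OF _ f] by blast
  fix U assume U: "openin (corona Y) U"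
  let ?V = "{p \<in> corona_points X. ?h p \<in> U}"
  have "corona_far X {p} (corona_points X - ?V)" if p: "p \<in> ?V" for p
  proof (rule corona_far_vimage[OF f])
    have "corona_far Y {?h p} (corona_points Y - U)"
      using U p unfolding openin_corona by auto
    then have "corona_far Y {?h p} (?h ` (corona_points X - ?V))"
      by (rule corona_far_antimono) (auto intro: corona_hom_in_corona_points[OF _ f])
    then show "corona_far Y (?h ` {p}) (?h ` (corona_points X - ?V))" by simp
  qed (use p in auto)
  then show "openin (corona X) ?V" unfolding openin_corona by blast
qed

section \<open>The functor laws\<close>

lemma corona_hom_ident:
  "corona_hom X X (close_maps X X `` {id}) = restrict id (corona_points X)"
proof (rule extensionalityI[OF corona_hom_extensional])
  fix p assume p: "p \<in> corona_points X"
  then show "corona_hom X X (close_maps X X `` {id}) p = restrict id (corona_points X) p"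
    by (auto elim!: corona_pointE simp: corona_hom_class id_coarse_map pushforward_id corona_pointI)
qed simp

lemma corona_hom_comp:
  assumes "f \<in> coarse_maps X Y" "g \<in> coarse_maps Y Z"
  shows "corona_hom X Z (close_maps X Z `` {g \<circ> f}) = compose (corona_points X)
    (corona_hom Y Z (close_maps Y Z `` {g})) (corona_hom X Y (close_maps X Y `` {f}))"
proof (rule extensionalityI[OF corona_hom_extensional compose_extensional])
  fix p assume p: "p \<in> corona_points X"
  then obtain F where "F \<in> coarse_ultrafilters X" "p = alike X `` {F}" by (rule corona_pointE)
  then show "corona_hom X Z (close_maps X Z `` {g \<circ> f}) p = compose (corona_points X)
    (corona_hom Y Z (close_maps Y Z `` {g})) (corona_hom X Y (close_maps X Y `` {f})) p"
    using p assms
    by (simp add: compose_def corona_hom_class comp_coarse_map pushforward_comp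
        pushforward_coarse_ultrafilter)
qed

lemma cat_functor_corona: "cat_functor mCoarse Top corona corona_hom"
proof (intro cat_functor.intro category_mCoarse category_Top cat_functor_axioms.intro)
  fix X :: "'a metric"
  show "corona X \<in> Obj Top" by (simp add: Top_def)
  show "corona_hom X X (ident mCoarse X) = ident Top (corona X)"
    by (simp add: ident_mCoarse corona_hom_ident Top_def topspace_corona)
next
  fix X Y :: "'a metric" and \<Phi> assume "\<Phi> \<in> Hom mCoarse X Y"
  then obtain f where "f \<in> coarse_maps X Y" "\<Phi> = close_maps X Y `` {f}" by (rule Hom_mCoarseE)
  then show "corona_hom X Y \<Phi> \<in> Hom Top (corona X) (corona Y)"
    by (simp add: Top_def topspace_corona corona_hom_extensional continuous_map_corona_hom)
next
  fix X Y Z :: "'a metric" and \<Phi> \<Psi>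
  assume "\<Phi> \<in> Hom mCoarse X Y" "\<Psi> \<in> Hom mCoarse Y Z"
  then obtain f g where "f \<in> coarse_maps X Y" "\<Phi> = close_maps X Y `` {f}"
    "g \<in> coarse_maps Y Z" "\<Psi> = close_maps Y Z `` {g}" by (metis Hom_mCoarseE)
  then show "corona_hom X Z (cmp mCoarse X Y Z \<Psi> \<Phi>) = cmp Top (corona X) (corona Y) (corona Z)
      (corona_hom Y Z \<Psi>) (corona_hom X Y \<Phi>)"
    by (simp add: cmp_mCoarse_class corona_hom_comp) (simp add: Top_def topspace_corona)
qed

section \<open>Compactness\<close>

definition set_ideal :: "'a set set \<Rightarrow> bool" where
  "set_ideal I \<longleftrightarrow> {} \<in> I \<and> (\<forall>A\<in>I. \<forall>B. B \<subseteq> A \<longrightarrow> B \<in> I) \<and> (\<forall>A\<in>I. \<forall>B\<in>I. A \<union> B \<in> I)"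

lemma set_idealI:
  assumes "{} \<in> I" "\<And>A B. A \<in> I \<Longrightarrow> B \<subseteq> A \<Longrightarrow> B \<in> I"
    "\<And>A B. A \<in> I \<Longrightarrow> B \<in> I \<Longrightarrow> A \<union> B \<in> I"
  shows "set_ideal I"
  using assms unfolding set_ideal_def by blast

lemma set_idealD:
  assumes "set_ideal I"
  shows "{} \<in> I" and "A \<in> I \<Longrightarrow> B \<subseteq> A \<Longrightarrow> B \<in> I" and "A \<in> I \<Longrightarrow> B \<in> I \<Longrightarrow> A \<union> B \<in> I"
  using assms unfolding set_ideal_def by blast+

text \<open>Zorn's lemma gives an ideal \<open>I\<close> maximal among those that contain
  \<open>J\<close> and avoid \<open>M\<close>. By maximality each \<open>A\<close> outside
  \<open>I\<close> covers \<open>M\<close> together with a member of \<open>I\<close>, and two such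
  coverings force primeness.\<close>

lemma set_ideal_extend_prime:
  assumes J: "set_ideal J" "M \<notin> J"
  obtains I where "set_ideal I" "J \<subseteq> I" "M \<notin> I" "\<And>A B. A \<inter> B \<in> I \<Longrightarrow> A \<in> I \<or> B \<in> I"
proof -
  define \<A> where "\<A> = {I. set_ideal I \<and> J \<subseteq> I \<and> M \<notin> I}"
  have "\<exists>I\<in>\<A>. \<forall>K\<in>\<A>. I \<subseteq> K \<longrightarrow> K = I"
  proof (rule subset_Zorn_nonempty)
    show "\<A> \<noteq> {}" using J unfolding \<A>_def by blast
    fix \<C> assume ne: "\<C> \<noteq> {}" and chain: "subset.chain \<A> \<C>"
    then have sub: "set_ideal I \<and> J \<subseteq> I \<and> M \<notin> I" if "I \<in> \<C>" for I
      using that unfolding \<A>_def subset_chain_def by blast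
    have "set_ideal (\<Union>\<C>)"
    proof (rule set_idealI)
      show "{} \<in> \<Union>\<C>" using ne sub set_idealD(1) by blast
      show "B \<in> \<Union>\<C>" if "A \<in> \<Union>\<C>" "B \<subseteq> A" for A B using that sub set_idealD(2) by blast
      fix A B assume "A \<in> \<Union>\<C>" "B \<in> \<Union>\<C>"
      then obtain K where "K \<in> \<C>" "A \<in> K" "B \<in> K"
        using chain unfolding subset_chain_def by blast
      then show "A \<union> B \<in> \<Union>\<C>" using sub set_idealD(3) by blast
    qed
    then show "\<Union>\<C> \<in> \<A>" using ne sub unfolding \<A>_def by blast
  qed
  then obtain I where I: "set_ideal I" "J \<subseteq> I" "M \<notin> I"
    and max: "\<And>K. set_ideal K \<Longrightarrow> I \<subseteq> K \<Longrightarrow> M \<notin> K \<Longrightarrow> K = I"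
    unfolding \<A>_def by (auto dest: order_trans)
  have covers: "\<exists>S\<in>I. M \<subseteq> S \<union> A" if A: "A \<notin> I" for A
  proof (rule ccontr)
    assume no: "\<not> (\<exists>S\<in>I. M \<subseteq> S \<union> A)"
    \<comment> \<open>The ideal generated by \<open>I\<close> and \<open>A\<close>. It avoids
      \<open>M\<close> by \<open>no\<close>, so maximality would put \<open>A\<close> into
      \<open>I\<close>.\<close>
    let ?K = "{B. \<exists>S\<in>I. B \<subseteq> S \<union> A}"
    have "set_ideal ?K"
    proof (rule set_idealI)
      show "B \<union> C \<in> ?K" if "B \<in> ?K" "C \<in> ?K" for B C
      proof -
        obtain S where "S \<in> I" "B \<subseteq> S \<union> A" using \<open>B \<in> ?K\<close> by blast
        moreover obtain T where "T \<in> I" "C \<subseteq> T \<union> A" using \<open>C \<in> ?K\<close> by blast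
        ultimately show ?thesis using set_idealD(3)[OF I(1)] by (auto intro!: bexI[of _ "S \<union> T"])
      qed
    qed (use set_idealD(1)[OF I(1)] in blast)+
    then have "?K = I" using max no by blast
    moreover have "A \<in> ?K" using set_idealD(1)[OF I(1)] by blast
    ultimately show False using A by blast
  qed
  have "A \<in> I \<or> B \<in> I" if AB: "A \<inter> B \<in> I" for A B
  proof (rule ccontr)
    assume no: "\<not> (A \<in> I \<or> B \<in> I)"
    obtain S where "S \<in> I" "M \<subseteq> S \<union> A" using no covers[of A] by blast
    moreover obtain T where "T \<in> I" "M \<subseteq> T \<union> B" using no covers[of B] by blast
    \<comment> \<open>A point of \<open>M\<close> outside \<open>S \<union> T\<close> lies in both
      \<open>A\<close> and \<open>B\<close>.\<close>
    ultimately have "(S \<union> T) \<union> (A \<inter> B) \<in> I" "M \<subseteq> (S \<union> T) \<union> (A \<inter> B)"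
      using set_idealD(3)[OF I(1)] AB by auto
    then show False using I(3) set_idealD(2)[OF I(1)] by metis
  qed
  then show thesis using that I by blast
qed

section \<open>Bounded sets and compactness of the corona\<close>

lemma bounded_Int_of_coarsely_disjoint:
  assumes "coarsely_disjoint X A B" "A \<subseteq> mspace X"
  shows "bounded_in X (A \<inter> B)"
proof -
  \<comment> \<open>A common point is at distance 0 from itself, so radius 0 suffices.\<close>
  have "A \<inter> B \<subseteq> both_near X 0 A B" 
    using assms(2) unfolding both_near_def by (auto intro!: bexI eq_refl simp: subset_iff)
  with assms(1) show ?thesis unfolding coarsely_disjoint_iff using bounded_in_subset by blast
qed

text \<open>Points near a bounded set form a bounded set, so \<open>B\<close> is coarsely disjoint
  from itself and \<open>corona_cl X B\<close> is disjoint from itself.\<close>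

lemma corona_cl_bounded:
  assumes "bounded_in X B"
  shows "corona_cl X B = {}"
proof -
  have "bounded_in X (both_near X r B B)" for r
    using assms by (rule bounded_in_thicken) (auto simp: both_near_def)
  then show ?thesis using corona_cl_disjoint[of X B B] unfolding coarsely_disjoint_iff by blast
qed

lemma compact_space_corona: "compact_space (corona X)"
  unfolding compact_space topspace_corona
proof (intro allI impI, elim conjE)
  fix \<U> assume op: "\<forall>U\<in>\<U>. openin (corona X) U" and cover: "\<Union>\<U> = corona_points X"
  define small where "small = {S. S \<subseteq> mspace X \<and> (\<exists>\<F>. finite \<F> \<and> \<F> \<subseteq> \<U> \<and> corona_cl X S \<subseteq> \<Union>\<F>)}"
  have smallI: "S \<in> small"
    if "S \<subseteq> mspace X" "finite \<F>" "\<F> \<subseteq> \<U>" "corona_cl X S \<subseteq> \<Union>\<F>" for S \<F>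
    unfolding small_def mem_Collect_eq using that by (intro conjI exI[of _ \<F>])
  have smallE: thesis if "S \<in> small"
    and "\<And>\<F>. S \<subseteq> mspace X \<Longrightarrow> finite \<F> \<Longrightarrow> \<F> \<subseteq> \<U> \<Longrightarrow> corona_cl X S \<subseteq> \<Union>\<F> \<Longrightarrow> thesis" for S thesis
    using that(1) unfolding small_def mem_Collect_eq by (elim conjE exE) (rule that(2))
  have bounded_small: "B \<in> small" if "bounded_in X B" for B
    using that corona_cl_bounded[OF that] by (intro smallI[of B "{}"]) (simp_all add: bounded_in_iff)
  have "set_ideal small"
  proof (rule set_idealI)
    show "{} \<in> small" by (rule bounded_small) (simp add: bounded_in_iff)
    show "T \<in> small" if S: "S \<in> small" and T: "T \<subseteq> S" for S T
      using S
    proof (rule smallE)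
      fix \<F> assume \<F>: "S \<subseteq> mspace X" "finite \<F>" "\<F> \<subseteq> \<U>" "corona_cl X S \<subseteq> \<Union>\<F>"
      show "T \<in> small"
        using T \<F>(1) corona_cl_mono[OF T \<F>(1)] \<F>(4) by (intro smallI[OF _ \<F>(2,3)]) simp_all
    qed
    fix S T assume S: "S \<in> small" and T: "T \<in> small"
    obtain \<F> where \<F>: "S \<subseteq> mspace X" "finite \<F>" "\<F> \<subseteq> \<U>" "corona_cl X S \<subseteq> \<Union>\<F>"
      using S by (rule smallE)
    obtain \<G> where \<G>: "T \<subseteq> mspace X" "finite \<G>" "\<G> \<subseteq> \<U>" "corona_cl X T \<subseteq> \<Union>\<G>"
      using T by (rule smallE)
    have "corona_cl X (S \<union> T) \<subseteq> \<Union>(\<F> \<union> \<G>)"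
      unfolding corona_cl_Un[OF \<F>(1) \<G>(1)] Union_Un_distrib by (rule Un_mono[OF \<F>(4) \<G>(4)])
    with \<F> \<G> show "S \<union> T \<in> small" by (intro smallI[of _ "\<F> \<union> \<G>"]) simp_all
  qed
  \<comment> \<open>This is a finite subcover, since \<open>corona_cl X (mspace X)\<close> is the
    whole corona.\<close>
  have "mspace X \<in> small"
  proof (rule ccontr)
    assume "mspace X \<notin> small"
    then obtain I where I: "set_ideal I" "small \<subseteq> I" "mspace X \<notin> I"
      and prime: "\<And>A B. A \<inter> B \<in> I \<Longrightarrow> A \<in> I \<or> B \<in> I"
      using set_ideal_extend_prime[OF \<open>set_ideal small\<close>, of "mspace X"] by blast
    define F where "F = Pow (mspace X) - I"
    \<comment> \<open>Primeness of \<open>I\<close> yields the closeness axiom for \<open>F\<close>,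
      and closure of \<open>I\<close> under unions yields the union axiom.\<close>
    have "close_sets X A B" if "A \<in> F" "B \<in> F" for A B
    proof
      assume "coarsely_disjoint X A B"
      then have "A \<inter> B \<in> small"
        using that(1) unfolding F_def by (intro bounded_small bounded_Int_of_coarsely_disjoint) simp_all
      then show False using I(2) prime that unfolding F_def by blast
    qed
    moreover have "A \<in> F \<or> B \<in> F" if "A \<union> B \<in> F" for A B
      using that set_idealD(3)[OF I(1), of A B] unfolding F_def by auto
    moreover have "F \<subseteq> Pow (mspace X)" "mspace X \<in> F" using I(3) unfolding F_def by auto
    ultimately have F: "F \<in> coarse_ultrafilters X"
      unfolding coarse_ultrafilters_def by simp
    let ?p = "alike X `` {F}"
    have p: "?p \<in> corona_points X" using F by (rule corona_pointI)
    then obtain U where U: "U \<in> \<U>" "?p \<in> U" using cover by blast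
    then have "corona_far X {?p} (corona_points X - U)"
      using op p unfolding openin_corona by auto
    then obtain A B where AB: "coarsely_disjoint X A B" "{?p} \<subseteq> corona_cl X A"
      "corona_points X - U \<subseteq> corona_cl X B" by (rule corona_farE)
    \<comment> \<open>Again \<open>A\<close> need not belong to \<open>F\<close>, but its
      neighbourhood \<open>D\<close> does. As \<open>D\<close> is coarsely disjoint from
      \<open>B\<close>, \<open>corona_cl X D\<close> misses the complement of \<open>U\<close>, and
      \<open>{U}\<close> alone covers it.\<close>
    obtain C D where CD: "C \<union> D = mspace X" "coarsely_disjoint X A C" "coarsely_disjoint X B D"
      using AB(1) by (rule coarsely_disjoint_separation)
    have "C \<notin> F" using corona_clI[OF F] corona_cl_disjoint[OF CD(2)] AB(2) by auto
    then have "D \<in> F" using coarse_ultrafilterD(3,4)[OF F] CD(1) by metis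
    moreover have "corona_cl X D \<subseteq> U"
    proof
      fix q assume q: "q \<in> corona_cl X D"
      then have "q \<notin> corona_cl X B" using corona_cl_disjoint[OF CD(3)] by auto
      moreover have "q \<in> corona_points X" using q by (simp add: corona_cl_def)
      ultimately show "q \<in> U" using AB(3) by auto
    qed
    then have "D \<in> small"
      using CD(1) U(1) by (intro smallI[of D "{U}"]) auto
    ultimately show False using I(2) unfolding F_def by blast
  qed
  then obtain \<F> where \<F>: "finite \<F>" "\<F> \<subseteq> \<U>" "corona_cl X (mspace X) \<subseteq> \<Union>\<F>"
    by (rule smallE)
  have "corona_points X \<subseteq> corona_cl X (mspace X)"
    using corona_cl_Un_mspace[of _ X "mspace X" "mspace X"] by blast
  with \<F>(3) have "corona_points X \<subseteq> \<Union>\<F>" by (rule order_trans[rotated])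
  moreover have "\<Union>\<F> \<subseteq> corona_points X" using Union_mono[OF \<F>(2)] cover by simp
  ultimately have "\<Union>\<F> = corona_points X" by simp
  with \<F>(1,2) show "\<exists>\<F>. finite \<F> \<and> \<F> \<subseteq> \<U> \<and> \<Union>\<F> = corona_points X"
    by (intro exI[of _ \<F>] conjI)
qed

theorem theoremA:
  "cat_functor (mCoarse :: ('a metric, ('a \<Rightarrow> 'a) set) precategory)
      (Top :: ('a set set set topology, 'a set set set \<Rightarrow> 'a set set set) precategory)
      corona corona_hom
    \<and> (\<forall>X :: 'a metric. compact_space (corona X))"
  using cat_functor_corona compact_space_corona by blast

end
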